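(* Let $K$ be a field, and let $J_1\subseteq I_1$ and $J_2\subseteq I_2$ be monomial ideals in $R=K[x_1,\ldots,x_n]$ such that $\mathcal{G}(I_1)\subset R_1=K[x_1,\ldots,x_m]$ and $\mathcal{G}(I_2)\subset R_2=K[x_{m+1},\ldots,x_n]$ for some $m\geq 1$. If $J_1$ is a demotion of $I_1$ and $J_2$ is a demotion of $I_2$, then $J_1+J_2$ is a demotion of $I_1+I_2$.
   Context: For ideals $J\subseteq I$ in a commutative Noetherian ring $R$, $J$ is a demotion of $I$ if $I^rJ^s=I^{r+s}\cap J^s$ for all integers $r,s\geq 0$ (with $I^0=J^0=R$). For a monomial ideal $I$, $\mathcal{G}(I)$ denotes its unique minimal set of monomial generators.
   Formalization: The formal statement also assumes G(J_1) ⊂ R_1 and G(J_2) ⊂ R_2; without this the claim is false, e.g. I_1=(x), I_2=(y), J_1=J_2=(xy) in K[x,y] with m=1, where xy is in (I_1+I_2)^2 ∩ (J_1+J_2) but not in (I_1+I_2)(J_1+J_2). *)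

theory Defs
  imports "HOL-Algebra.Ideal_Product" "HOL-Library.Poly_Mapping"
begin

text \<open>A polynomial is a finitely supported function from exponents to coefficients, an exponent
  being a finitely supported function from variable indices to naturals.\<close>

type_synonym 'k mpoly = "(nat \<Rightarrow>\<^sub>0 nat) \<Rightarrow>\<^sub>0 'k"

text \<open>The ring \<open>K[x\<^sub>i | i \<in> V]\<close>, where \<open>K\<close> is the type \<open>'k\<close>. For \<open>V \<subseteq> W\<close> it is literally
  a subring of the ring with variables \<open>W\<close>.\<close>

definition poly_ring :: "nat set \<Rightarrow> 'k::field mpoly ring"
  where "poly_ring V =
    \<lparr>carrier = {p. \<forall>t \<in> Poly_Mapping.keys p. Poly_Mapping.keys t \<subseteq> V},
      mult = (*), one = 1, zero = 0, add = (+)\<rparr>"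

definition monomials :: "nat set \<Rightarrow> 'k::field mpoly set"
  where "monomials V = {Poly_Mapping.single t 1 | t. Poly_Mapping.keys t \<subseteq> V}"

definition monomial_ideal :: "nat set \<Rightarrow> 'k::field mpoly set \<Rightarrow> bool"
  where "monomial_ideal V I \<longleftrightarrow> (\<exists>S \<subseteq> monomials V. I = Idl\<^bsub>poly_ring V\<^esub> S)"

definition is_min_monomial_gens ::
    "nat set \<Rightarrow> 'k::field mpoly set \<Rightarrow> 'k mpoly set \<Rightarrow> bool"
  where "is_min_monomial_gens V I S \<longleftrightarrow>
    S \<subseteq> monomials V \<and> Idl\<^bsub>poly_ring V\<^esub> S = I \<and> (\<forall>T. T \<subset> S \<longrightarrow> Idl\<^bsub>poly_ring V\<^esub> T \<noteq> I)"

text \<open>\<open>\<G>(I)\<close>. The description is well-defined for monomial ideals, see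
  \<open>ex1_min_monomial_gens\<close> below.\<close>

definition min_monomial_gens :: "nat set \<Rightarrow> 'k::field mpoly set \<Rightarrow> 'k mpoly set"
  where "min_monomial_gens V I = (THE S. is_min_monomial_gens V I S)"

text \<open>Powers of ideals are taken in the semiring \<^term>\<open>ideals_set R\<close>, so that the zeroth power
  is \<^term>\<open>carrier R\<close>. The notion is meant for commutative Noetherian \<open>R\<close>; it is only used
  here for polynomial rings in finitely many variables over a field.\<close>

definition demotion :: "('a, 'b) ring_scheme \<Rightarrow> 'a set \<Rightarrow> 'a set \<Rightarrow> bool"
  where "demotion R J I \<longleftrightarrow> ideal J R \<and> ideal I R \<and> J \<subseteq> I \<and>
    (\<forall>r s :: nat. (I [^]\<^bsub>ideals_set R\<^esub> r) \<cdot>\<^bsub>R\<^esub> (J [^]\<^bsub>ideals_set R\<^esub> s) =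
      (I [^]\<^bsub>ideals_set R\<^esub> (r + s)) \<inter> (J [^]\<^bsub>ideals_set R\<^esub> s))"

lemma keys_add_nat:
  "Poly_Mapping.keys (a + b) = Poly_Mapping.keys a \<union> Poly_Mapping.keys (b :: nat \<Rightarrow>\<^sub>0 nat)"
  by (auto simp: in_keys_iff lookup_add)

lemma keys_in_carrier_mult:
  assumes "p \<in> carrier (poly_ring V)" "q \<in> carrier (poly_ring V)"
  shows "p * q \<in> carrier (poly_ring V :: 'k::field mpoly ring)"
proof -
  have "Poly_Mapping.keys t \<subseteq> V" if t: "t \<in> Poly_Mapping.keys (p * q)" for t
  proof -
    obtain a b where "t = a + b" "a \<in> Poly_Mapping.keys p" "b \<in> Poly_Mapping.keys q"
      using keys_mult[of p q] t by auto
    then show ?thesis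
      using assms by (auto simp: poly_ring_def keys_add_nat)
  qed
  then show ?thesis
    by (auto simp: poly_ring_def)
qed

lemma single_in_carrier:
  "Poly_Mapping.keys t \<subseteq> V \<Longrightarrow> Poly_Mapping.single t c \<in> carrier (poly_ring V)"
  by (auto simp: poly_ring_def split: if_splits)

lemma cring_poly_ring: "cring (poly_ring V :: 'k::field mpoly ring)"
proof (rule cringI)
  show "abelian_group (poly_ring V :: 'k mpoly ring)"
  proof (rule abelian_groupI)
    fix p assume "p \<in> carrier (poly_ring V :: 'k mpoly ring)"
    then show "\<exists>q \<in> carrier (poly_ring V). q \<oplus>\<^bsub>poly_ring V\<^esub> p = \<zero>\<^bsub>poly_ring V\<^esub>"
      by (intro bexI[of _ "- p"]) (auto simp: poly_ring_def)
  next
    fix p q assume "p \<in> carrier (poly_ring V :: 'k mpoly ring)"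
      and "q \<in> carrier (poly_ring V :: 'k mpoly ring)"
    then show "p \<oplus>\<^bsub>poly_ring V\<^esub> q \<in> carrier (poly_ring V)"
      using keys_add[of p q] by (auto simp: poly_ring_def)
  qed (auto simp: poly_ring_def ac_simps)
  show "Group.comm_monoid (poly_ring V :: 'k mpoly ring)"
  proof (rule comm_monoidI)
    fix p q assume "p \<in> carrier (poly_ring V :: 'k mpoly ring)"
      and "q \<in> carrier (poly_ring V :: 'k mpoly ring)"
    then have "p * q \<in> carrier (poly_ring V)"
      by (rule keys_in_carrier_mult)
    then show "p \<otimes>\<^bsub>poly_ring V\<^esub> q \<in> carrier (poly_ring V)"
      by (simp add: poly_ring_def)
  qed (auto simp: poly_ring_def ac_simps)
qed (simp add: poly_ring_def distrib_right)

lemma genideal_monomials: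
  fixes V :: "nat set" and A :: "(nat \<Rightarrow>\<^sub>0 nat) set"
  assumes A: "\<And>a. a \<in> A \<Longrightarrow> Poly_Mapping.keys a \<subseteq> V"
  shows "Idl\<^bsub>poly_ring V\<^esub> ((\<lambda>a. Poly_Mapping.single a (1::'k::field)) ` A) =
    {p \<in> carrier (poly_ring V). \<forall>t \<in> Poly_Mapping.keys p. \<exists>a \<in> A. \<exists>w. t = a + w}"
    (is "Idl\<^bsub>?R\<^esub> ?S = ?I")
proof
  interpret cring ?R by (rule cring_poly_ring)
  have S: "?S \<subseteq> carrier ?R"
    using A single_in_carrier by blast
  have minus: "\<ominus>\<^bsub>?R\<^esub> p = - p" if "p \<in> carrier ?R" for p
    by (rule minus_equality) (use that in \<open>auto simp: poly_ring_def\<close>)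
  have I: "ideal ?I ?R"
  proof (rule idealI)
    show "ring ?R" by (rule ring_axioms)
    show "subgroup ?I (add_monoid ?R)"
    proof
      fix p q assume p: "p \<in> ?I" and q: "q \<in> ?I"
      then have "p \<oplus>\<^bsub>?R\<^esub> q \<in> carrier ?R"
        by auto
      moreover have "\<exists>a \<in> A. \<exists>w. t = a + w" if "t \<in> Poly_Mapping.keys (p + q)" for t
        using keys_add[of p q] that p q by blast
      ultimately show "p \<otimes>\<^bsub>add_monoid ?R\<^esub> q \<in> ?I"
        by (simp add: poly_ring_def)
    next
      fix p assume p: "p \<in> ?I"
      then have "inv\<^bsub>add_monoid ?R\<^esub> p = - p"
        using minus[of p] by (simp add: a_inv_def)
      with p show "inv\<^bsub>add_monoid ?R\<^esub> p \<in> ?I"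
        by (simp add: poly_ring_def)
    qed (auto simp: poly_ring_def)
    fix p q assume p: "p \<in> ?I" and q: "q \<in> carrier ?R"
    have "\<exists>a \<in> A. \<exists>w. t = a + w" if t: "t \<in> Poly_Mapping.keys (p * q)" for t
    proof -
      obtain u v where "t = u + v" "u \<in> Poly_Mapping.keys p"
        using keys_mult[of p q] t by auto
      with p obtain a w where "a \<in> A" "t = a + (w + v)"
        by (auto simp: add.assoc)
      then show ?thesis by blast
    qed
    moreover have "p * q \<in> carrier ?R"
      using p q by (intro keys_in_carrier_mult) auto
    ultimately show "p \<otimes>\<^bsub>?R\<^esub> q \<in> ?I" "q \<otimes>\<^bsub>?R\<^esub> p \<in> ?I"
      by (auto simp: poly_ring_def mult.commute[of q p])
  qed
  have "?S \<subseteq> ?I"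
    using S by (auto intro!: bexI exI[of _ 0])
  then show "Idl\<^bsub>?R\<^esub> ?S \<subseteq> ?I"
    by (rule genideal_minimal[OF I])
  show "?I \<subseteq> Idl\<^bsub>?R\<^esub> ?S"
  proof
    fix p assume p: "p \<in> ?I"
    interpret J: ideal "Idl\<^bsub>?R\<^esub> ?S" ?R
      by (rule genideal_ideal[OF S])
    have add: "u + v \<in> Idl\<^bsub>?R\<^esub> ?S" if "u \<in> Idl\<^bsub>?R\<^esub> ?S" "v \<in> Idl\<^bsub>?R\<^esub> ?S" for u v
      using J.a_closed[OF that] by (simp add: poly_ring_def)
    have zero: "0 \<in> Idl\<^bsub>?R\<^esub> ?S"
      using J.zero_closed by (simp add: poly_ring_def)
    have single: "Poly_Mapping.single t c \<in> Idl\<^bsub>?R\<^esub> ?S" if t: "t \<in> Poly_Mapping.keys p" for t c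
    proof -
      from p t obtain a w where aw: "a \<in> A" "t = a + w" by blast
      have "Poly_Mapping.keys t \<subseteq> V" using p t by (auto simp: poly_ring_def)
      then have w: "Poly_Mapping.single w c \<in> carrier ?R"
        using aw by (auto simp: poly_ring_def keys_add_nat)
      have "Poly_Mapping.single a 1 \<in> Idl\<^bsub>?R\<^esub> ?S"
        using genideal_self[OF S] aw(1) by blast
      from J.I_r_closed[OF this w] show ?thesis
        by (simp add: poly_ring_def mult_single aw(2))
    qed
    have "(\<Sum>t\<in>F. Poly_Mapping.single t (Poly_Mapping.lookup p t)) \<in> Idl\<^bsub>?R\<^esub> ?S"
      if "finite F" "F \<subseteq> Poly_Mapping.keys p" for F
      using that by (induction F) (auto intro: add zero single)
    from this[OF finite_keys order_refl]
    have "(\<Sum>t\<in>Poly_Mapping.keys p. Poly_Mapping.single t (Poly_Mapping.lookup p t))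
        \<in> Idl\<^bsub>?R\<^esub> ?S" .
    moreover have "p = (\<Sum>t\<in>Poly_Mapping.keys p. Poly_Mapping.single t (Poly_Mapping.lookup p t))"
    proof (rule poly_mapping_eqI)
      fix u
      have "(\<Sum>t\<in>Poly_Mapping.keys p. Poly_Mapping.lookup (Poly_Mapping.single t (Poly_Mapping.lookup p t)) u) =
          (\<Sum>t\<in>Poly_Mapping.keys p. if t = u then Poly_Mapping.lookup p u else 0)"
        by (rule sum.cong) (auto simp: lookup_single when_def)
      then show "Poly_Mapping.lookup p u = Poly_Mapping.lookup
          (\<Sum>t\<in>Poly_Mapping.keys p. Poly_Mapping.single t (Poly_Mapping.lookup p t)) u"
        by (auto simp: lookup_sum in_keys_iff)
    qed
    ultimately show "p \<in> Idl\<^bsub>?R\<^esub> ?S" by simp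
  qed
qed

lemma ex1_min_monomial_gens:
  fixes I :: "'k::field mpoly set"
  assumes "monomial_ideal V I"
  shows "\<exists>!S. is_min_monomial_gens V I S"
proof -
  let ?m = "\<lambda>a. Poly_Mapping.single a (1::'k)"
  let ?below = "\<lambda>A t. \<exists>a \<in> A. \<exists>w. t = a + (w :: nat \<Rightarrow>\<^sub>0 nat)"
  have exps: "\<exists>A. S = ?m ` A \<and> (\<forall>a \<in> A. Poly_Mapping.keys a \<subseteq> V)" if "S \<subseteq> monomials V" for S
  proof (intro exI conjI)
    show "S = ?m ` {t. Poly_Mapping.keys t \<subseteq> V \<and> ?m t \<in> S}"
      using that by (auto simp: monomials_def)
  qed auto
  have mem: "?m t \<in> Idl\<^bsub>poly_ring V\<^esub> (?m ` A) \<longleftrightarrow> Poly_Mapping.keys t \<subseteq> V \<and> ?below A t"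
    if "\<forall>a \<in> A. Poly_Mapping.keys a \<subseteq> V" for A t
  proof -
    have "?m t \<in> carrier (poly_ring V) \<longleftrightarrow> Poly_Mapping.keys t \<subseteq> V"
      by (simp add: poly_ring_def)
    moreover have "Poly_Mapping.keys (?m t) = {t}" by simp
    moreover have "Idl\<^bsub>poly_ring V\<^esub> (?m ` A) =
        {p \<in> carrier (poly_ring V). \<forall>t \<in> Poly_Mapping.keys p. ?below A t}"
      by (rule genideal_monomials) (use that in blast)
    ultimately show ?thesis by simp
  qed
  have eqI: "Idl\<^bsub>poly_ring V\<^esub> (?m ` A) = Idl\<^bsub>poly_ring V\<^esub> (?m ` B)"
    if "\<forall>a \<in> A. Poly_Mapping.keys a \<subseteq> V" "\<forall>b \<in> B. Poly_Mapping.keys b \<subseteq> V"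
      "\<And>a. a \<in> A \<Longrightarrow> ?below B a" "\<And>b. b \<in> B \<Longrightarrow> ?below A b" for A B
  proof -
    have "?below A t \<longleftrightarrow> ?below B t" for t
      using that(3,4) by (metis add.assoc)
    then show ?thesis
      using genideal_monomials[where 'k = 'k, of A V] genideal_monomials[where 'k = 'k, of B V]
        that(1,2) by simp
  qed
  obtain S where S: "S \<subseteq> monomials V" "I = Idl\<^bsub>poly_ring V\<^esub> S"
    using assms by (auto simp: monomial_ideal_def)
  obtain A where A: "S = ?m ` A" "\<forall>a \<in> A. Poly_Mapping.keys a \<subseteq> V"
    using exps[OF S(1)] by blast
  let ?M = "{t. ?m t \<in> I}"
  define G where "G = {t \<in> ?M. \<forall>u w. t = u + w \<and> u \<in> ?M \<longrightarrow> w = 0}"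
  have M: "t \<in> ?M \<longleftrightarrow> Poly_Mapping.keys t \<subseteq> V \<and> ?below A t" for t
    using mem[OF A(2)] S(2) A(1) by simp
  have GV: "\<forall>g \<in> G. Poly_Mapping.keys g \<subseteq> V"
    using M by (auto simp: G_def)
  define d where "d t = (\<Sum>i\<in>Poly_Mapping.keys t. Poly_Mapping.lookup t i)" for t :: "nat \<Rightarrow>\<^sub>0 nat"
  have dlt: "d u < d (u + w)" if "w \<noteq> 0" for u w
  proof -
    let ?K = "Poly_Mapping.keys u \<union> Poly_Mapping.keys w"
    have "d (u + w) = (\<Sum>i\<in>?K. Poly_Mapping.lookup u i) +
        (\<Sum>i\<in>?K. Poly_Mapping.lookup w i)"
      by (simp add: d_def keys_add_nat lookup_add sum.distrib)
    also have "(\<Sum>i\<in>?K. Poly_Mapping.lookup u i) = d u"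
      unfolding d_def by (rule sum.mono_neutral_right) (auto simp: in_keys_iff)
    also have "(\<Sum>i\<in>?K. Poly_Mapping.lookup w i) = d w"
      unfolding d_def by (rule sum.mono_neutral_right) (auto simp: in_keys_iff)
    finally have "d (u + w) = d u + d w" .
    moreover have "d w \<noteq> 0"
      using that by (auto simp: d_def poly_mapping_eq_iff fun_eq_iff in_keys_iff)
    ultimately show ?thesis by simp
  qed
  have below_G: "?below G t" if "t \<in> ?M" for t
    using that
  proof (induction "d t" arbitrary: t rule: less_induct)
    case less
    show ?case
    proof (cases "t \<in> G")
      case True
      then show ?thesis by (metis add.right_neutral)
    next
      case False
      then obtain u w where uw: "t = u + w" "u \<in> ?M" "w \<noteq> 0"
        using less.prems by (auto simp: G_def)
      with less.hyps[of u] dlt[of w u] show ?thesis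
        by (metis add.assoc)
    qed
  qed
  have idl_G: "Idl\<^bsub>poly_ring V\<^esub> (?m ` G) = I"
    unfolding S(2) A(1)
  proof (rule eqI[OF GV A(2)])
    show "?below A g" if "g \<in> G" for g
      using that M by (auto simp: G_def)
    show "?below G a" if "a \<in> A" for a
      using that below_G[of a] M[of a] A(2) by (metis add.right_neutral)
  qed
  have G_sub: "G \<subseteq> B" if B: "\<forall>b \<in> B. Poly_Mapping.keys b \<subseteq> V"
    "Idl\<^bsub>poly_ring V\<^esub> (?m ` B) = I" for B
  proof
    fix g assume g: "g \<in> G"
    then have "?m g \<in> Idl\<^bsub>poly_ring V\<^esub> (?m ` B)"
      using B(2) by (simp add: G_def)
    then obtain b w where b: "b \<in> B" "g = b + w"
      using mem[OF B(1)] by blast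
    have "b = b + 0" by simp
    then have "?m b \<in> Idl\<^bsub>poly_ring V\<^esub> (?m ` B)"
      using mem[OF B(1), of b] B(1) b(1) by blast
    then have "w = 0"
      using g b(2) B(2) by (auto simp: G_def)
    with b show "g \<in> B" by simp
  qed
  have sub: "?m ` G \<subseteq> T" if "T \<subseteq> monomials V" "Idl\<^bsub>poly_ring V\<^esub> T = I" for T
    using exps[OF that(1)] G_sub that(2) by blast
  have G_mon: "?m ` G \<subseteq> monomials V"
    using GV by (auto simp: monomials_def)
  show ?thesis
  proof (rule ex1I[of _ "?m ` G"])
    show "is_min_monomial_gens V I (?m ` G)"
      unfolding is_min_monomial_gens_def
      using G_mon idl_G sub by (meson dual_order.trans less_le_not_le)
    show "T = ?m ` G" if "is_min_monomial_gens V I T" for T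
      using that sub[of T] idl_G unfolding is_min_monomial_gens_def by blast
  qed
qed

end

theory Submission
  imports Defs "HOL-Library.Set_Algebras"
begin

text \<open>A monomial ideal consists of the polynomials all of whose exponents lie in a fixed
  translation-closed set \<open>A\<close> of exponents, so statements about monomial ideals can be read off from
  sets of exponents: a sum of ideals becomes a union, a product becomes a sumset, and an
  intersection stays an intersection (\<open>set_add_mono_span\<close>, \<open>ideal_prod_mono_span\<close>). The gain is
  that intersection now distributes over the sum of ideals. The translation of the demotion
  property is \<open>demotion_mono_span_iff\<close>.

  Let \<open>t\<close> be an exponent in \<open>(I\<^sub>1 + I\<^sub>2)\<^bsup>r+s\<^esup> \<inter> (J\<^sub>1 + J\<^sub>2)\<^sup>s\<close>; here ideals stand for their exponent
  sets. Expanding both powers gives \<open>i + j = r + s\<close> and \<open>a + b = s\<close> such that \<open>t\<close> lies in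
  \<open>I\<^sub>1\<^sup>i\<close>, \<open>I\<^sub>2\<^sup>j\<close>, \<open>J\<^sub>1\<^sup>a\<close> and \<open>J\<^sub>2\<^sup>b\<close>. As \<open>J\<^sub>1\<close> is a demotion of \<open>I\<^sub>1\<close>, the exponent \<open>t\<close> lies in
  \<open>I\<^sub>1\<^bsup>i-a\<^esup>J\<^sub>1\<^sup>a\<close>, where \<open>i - a\<close> is truncated at \<open>0\<close>; likewise it lies in \<open>I\<^sub>2\<^bsup>j-b\<^esup>J\<^sub>2\<^sup>b\<close>. The
  first of these ideals is generated in the variables of \<open>R\<^sub>1\<close> and the second in those of \<open>R\<^sub>2\<close>, and
  for such ideals the intersection is the product (\<open>cylindrical_Int_eq_plus\<close>). So \<open>t\<close> lies in
  \<open>I\<^sub>1\<^bsup>i-a\<^esup>I\<^sub>2\<^bsup>j-b\<^esup> J\<^sub>1\<^sup>aJ\<^sub>2\<^sup>b\<close>, and \<open>(i - a) + (j - b) \<ge> r\<close>. The reverse inclusion holds for all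
  ideals with \<open>J \<subseteq> I\<close>.\<close>

section \<open>Translation-closed sets of exponents\<close>

type_synonym exponent = "nat \<Rightarrow>\<^sub>0 nat"

definition exponents :: "nat set \<Rightarrow> exponent set"
  where "exponents V = {t. Poly_Mapping.keys t \<subseteq> V}"

text \<open>These are the exponent sets of the monomial ideals in the variables \<open>V\<close>.\<close>

definition exponent_ideal :: "nat set \<Rightarrow> exponent set \<Rightarrow> bool"
  where "exponent_ideal V A \<longleftrightarrow> A \<subseteq> exponents V \<and> A + exponents V \<subseteq> A"

text \<open>The exponents of \<open>I\<^sup>k\<close>; the base case matches \<open>I\<^sup>0 = R\<close>.\<close>

primrec sum_power :: "nat set \<Rightarrow> exponent set \<Rightarrow> nat \<Rightarrow> exponent set"
  where
    "sum_power V A 0 = exponents V"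
  | "sum_power V A (Suc k) = sum_power V A k + A"

lemma zero_in_exponents: "0 \<in> exponents V"
  by (simp add: exponents_def)

lemma add_in_exponents_iff: "a + b \<in> exponents V \<longleftrightarrow> a \<in> exponents V \<and> b \<in> exponents V"
  by (simp add: exponents_def keys_add_nat)

lemma exponent_ideal_exponents: "exponent_ideal V (exponents V)"
  by (auto simp: exponent_ideal_def add_in_exponents_iff elim!: set_plus_elim)

lemma exponent_ideal_plus_exponents:
  assumes "exponent_ideal V A"
  shows "A + exponents V = A"
proof
  show "A + exponents V \<subseteq> A"
    using assms by (simp add: exponent_ideal_def)
  show "A \<subseteq> A + exponents V"
    using zero_in_exponents by (metis add.right_neutral set_plus_intro subsetI)
qed

lemma exponent_ideal_plus:
  assumes "exponent_ideal V A" "exponent_ideal V B"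
  shows "exponent_ideal V (A + B)"
  unfolding exponent_ideal_def
proof
  show "A + B \<subseteq> exponents V"
    using assms by (auto simp: exponent_ideal_def add_in_exponents_iff elim!: set_plus_elim)
  show "A + B + exponents V \<subseteq> A + B"
    using exponent_ideal_plus_exponents[OF assms(2)] by (simp add: add.assoc)
qed

lemma exponent_ideal_Un:
  assumes "exponent_ideal V A" "exponent_ideal V B"
  shows "exponent_ideal V (A \<union> B)"
  using assms unfolding exponent_ideal_def Un_set_plus by blast

lemma exponent_ideal_plus_subset_left:
  assumes "exponent_ideal V A" "exponent_ideal V B"
  shows "A + B \<subseteq> A"
proof -
  have "A + B \<subseteq> A + exponents V"
    using assms(2) by (intro set_plus_mono2) (auto simp: exponent_ideal_def)
  then show ?thesis
    using exponent_ideal_plus_exponents[OF assms(1)] by simp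
qed

lemma exponent_ideal_plus_subset_right:
  assumes "exponent_ideal V A" "exponent_ideal V B"
  shows "A + B \<subseteq> B"
  using exponent_ideal_plus_subset_left[OF assms(2,1)] by (simp add: add.commute)

lemma exponent_ideal_sum_power: "exponent_ideal V A \<Longrightarrow> exponent_ideal V (sum_power V A k)"
  by (induction k) (auto intro: exponent_ideal_exponents exponent_ideal_plus)

lemma sum_power_add:
  assumes "exponent_ideal V A"
  shows "sum_power V A (r + s) = sum_power V A r + sum_power V A s"
proof (induction s)
  case 0
  then show ?case
    using exponent_ideal_plus_exponents[OF exponent_ideal_sum_power[OF assms]] by simp
qed (simp add: add.assoc)

lemma sum_power_mono: "A \<subseteq> B \<Longrightarrow> sum_power V A k \<subseteq> sum_power V B k"
  by (induction k) (simp_all add: set_plus_mono2)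

lemma sum_power_antimono:
  assumes "exponent_ideal V A" "k \<le> l"
  shows "sum_power V A l \<subseteq> sum_power V A k"
  using exponent_ideal_plus_subset_left[OF assms(1)[THEN exponent_ideal_sum_power]
      assms(1)[THEN exponent_ideal_sum_power], of k "l - k"] assms
  by (simp flip: sum_power_add)

text \<open>This is the expansion of \<open>(I + J)\<^sup>k\<close> into the terms \<open>I\<^sup>iJ\<^sup>j\<close>, with membership in the product
  weakened to membership in each factor: the demotion hypotheses speak about one factor at a
  time.\<close>

lemma sum_power_UnE:
  assumes A: "exponent_ideal V A" and B: "exponent_ideal V B"
    and "t \<in> sum_power V (A \<union> B) k"
  obtains i j where "i + j = k" "t \<in> sum_power V A i" "t \<in> sum_power V B j"
proof -
  have "\<exists>i j. i + j = k \<and> t \<in> sum_power V A i \<and> t \<in> sum_power V B j"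
    using assms(3)
  proof (induction k arbitrary: t)
    case 0
    then show ?case by simp
  next
    case (Suc k)
    then obtain u v where t: "t = u + v" "u \<in> sum_power V (A \<union> B) k" "v \<in> A \<union> B"
      by (auto elim: set_plus_elim)
    with Suc.IH obtain i j where ij: "i + j = k" "u \<in> sum_power V A i" "u \<in> sum_power V B j"
      by blast
    have "v \<in> exponents V"
      using t(3) A B by (auto simp: exponent_ideal_def)
    then have "t \<in> sum_power V A i" "t \<in> sum_power V B j"
      using ij(2,3) t(1) exponent_ideal_sum_power[OF A, of i] exponent_ideal_sum_power[OF B, of j]
      by (auto simp: exponent_ideal_def intro: set_plus_intro)
    moreover have "t \<in> sum_power V A (Suc i)" if "v \<in> A"
      using ij(2) t(1) that by (auto intro: set_plus_intro)
    moreover have "t \<in> sum_power V B (Suc j)" if "v \<in> B"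
      using ij(3) t(1) that by (auto intro: set_plus_intro)
    moreover have "Suc i + j = Suc k" "i + Suc j = Suc k"
      using ij(1) by simp_all
    ultimately show ?case
      using t(3) by blast
  qed
  then show thesis
    using that by blast
qed

section \<open>Exponent sets that depend on part of the variables\<close>

definition restrict_exponent :: "nat set \<Rightarrow> exponent \<Rightarrow> exponent"
  where "restrict_exponent W t = Poly_Mapping.mapp (\<lambda>i c. c when i \<in> W) t"

text \<open>For a translation-closed set this says that the ideal is generated in the variables of
  \<open>W\<close>.\<close>

definition cylindrical :: "nat set \<Rightarrow> exponent set \<Rightarrow> bool"
  where "cylindrical W A \<longleftrightarrow> (\<forall>t \<in> A. restrict_exponent W t \<in> A)"

lemma lookup_restrict_exponent:
  "Poly_Mapping.lookup (restrict_exponent W t) i = (Poly_Mapping.lookup t i when i \<in> W)"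
  by (auto simp: restrict_exponent_def lookup_mapp when_def in_keys_iff)

lemma restrict_exponent_add:
  "restrict_exponent W (a + b) = restrict_exponent W a + restrict_exponent W b"
  by (rule poly_mapping_eqI) (simp add: lookup_restrict_exponent lookup_add when_def)

lemma restrict_exponent_ident: "t \<in> exponents W \<Longrightarrow> restrict_exponent W t = t"
  by (rule poly_mapping_eqI)
    (auto simp: lookup_restrict_exponent when_def exponents_def in_keys_iff)

lemma restrict_exponent_split:
  assumes "W \<inter> W' = {}" "t \<in> exponents (W \<union> W')"
  shows "restrict_exponent W t + restrict_exponent W' t = t"
proof (rule poly_mapping_eqI)
  fix i
  have "Poly_Mapping.lookup t i = 0" if "i \<notin> W" "i \<notin> W'"
    using assms(2) that by (auto simp: exponents_def in_keys_iff)
  moreover have "\<not> (i \<in> W \<and> i \<in> W')"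
    using assms(1) by blast
  ultimately show "Poly_Mapping.lookup (restrict_exponent W t + restrict_exponent W' t) i =
      Poly_Mapping.lookup t i"
    by (auto simp: lookup_restrict_exponent lookup_add when_def)
qed

lemma restrict_in_exponents: "t \<in> exponents V \<Longrightarrow> restrict_exponent W t \<in> exponents V"
  by (auto simp: exponents_def in_keys_iff lookup_restrict_exponent when_def split: if_splits)

lemma cylindrical_plus: "cylindrical W A \<Longrightarrow> cylindrical W B \<Longrightarrow> cylindrical W (A + B)"
  by (auto simp: cylindrical_def restrict_exponent_add intro!: set_plus_intro elim!: set_plus_elim)

lemma cylindrical_sum_power: "cylindrical W A \<Longrightarrow> cylindrical W (sum_power V A k)"
  by (induction k) (simp_all add: cylindrical_plus, simp add: cylindrical_def restrict_in_exponents)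

text \<open>An exponent in the intersection is the sum of its restrictions to the two disjoint sets of
  variables, and each restriction stays in the respective set.\<close>

lemma cylindrical_Int_eq_plus:
  assumes A: "exponent_ideal V A" "cylindrical W A"
    and B: "exponent_ideal V B" "cylindrical W' B"
    and W: "V = W \<union> W'" "W \<inter> W' = {}"
  shows "A \<inter> B = A + B"
proof
  show "A \<inter> B \<subseteq> A + B"
  proof
    fix t assume t: "t \<in> A \<inter> B"
    then have "restrict_exponent W t + restrict_exponent W' t \<in> A + B"
      using A(2) B(2) by (auto simp: cylindrical_def intro: set_plus_intro)
    moreover have "t \<in> exponents (W \<union> W')"
      using t A(1) W(1) by (auto simp: exponent_ideal_def)
    ultimately show "t \<in> A + B"
      using restrict_exponent_split[OF W(2)] by simp
  qed
  show "A + B \<subseteq> A \<inter> B"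
    using exponent_ideal_plus_subset_left[OF A(1) B(1)]
      exponent_ideal_plus_subset_right[OF A(1) B(1)] by blast
qed

section \<open>Demotions of exponent sets\<close>

definition exponent_demotion :: "nat set \<Rightarrow> exponent set \<Rightarrow> exponent set \<Rightarrow> bool"
  where "exponent_demotion V B A \<longleftrightarrow> B \<subseteq> A \<and>
    (\<forall>r s. sum_power V A r + sum_power V B s = sum_power V A (r + s) \<inter> sum_power V B s)"

text \<open>For \<open>i < a\<close> the exponent \<open>i - a\<close> is \<open>0\<close> and the claim reduces to \<open>B\<^sup>a \<subseteq> A\<^sup>a\<close>.\<close>

lemma exponent_demotion_truncated:
  assumes "exponent_demotion V B A"
    and "t \<in> sum_power V A i" "t \<in> sum_power V B a"
  shows "t \<in> sum_power V A (i - a) + sum_power V B a"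
proof -
  have "sum_power V B a \<subseteq> sum_power V A a"
    using assms(1) by (intro sum_power_mono) (simp add: exponent_demotion_def)
  then have "t \<in> sum_power V A (i - a + a)"
    using assms(2,3) by (cases "a \<le> i") auto
  with assms(1,3) show ?thesis
    by (simp add: exponent_demotion_def)
qed

lemma exponent_demotion_Un:
  assumes ideals: "exponent_ideal V A1" "exponent_ideal V B1" "exponent_ideal V A2"
      "exponent_ideal V B2"
    and cyl1: "cylindrical W1 A1" "cylindrical W1 B1"
    and cyl2: "cylindrical W2 A2" "cylindrical W2 B2"
    and W: "V = W1 \<union> W2" "W1 \<inter> W2 = {}"
    and dem: "exponent_demotion V B1 A1" "exponent_demotion V B2 A2"
  shows "exponent_demotion V (B1 \<union> B2) (A1 \<union> A2)"
  unfolding exponent_demotion_def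
proof (intro conjI allI)
  let ?A = "A1 \<union> A2" and ?B = "B1 \<union> B2"
  note A = exponent_ideal_Un[OF ideals(1,3)] and B = exponent_ideal_Un[OF ideals(2,4)]
  note pow = exponent_ideal_sum_power
  show BA: "?B \<subseteq> ?A"
    using dem by (auto simp: exponent_demotion_def)
  fix r s
  show "sum_power V ?A r + sum_power V ?B s = sum_power V ?A (r + s) \<inter> sum_power V ?B s"
  proof
    have "sum_power V ?A r + sum_power V ?B s \<subseteq> sum_power V ?A r + sum_power V ?A s"
      using sum_power_mono[OF BA] by (intro set_plus_mono2) auto
    moreover have "sum_power V ?A r + sum_power V ?B s \<subseteq> sum_power V ?B s"
      using A B by (intro exponent_ideal_plus_subset_right[OF pow pow])
    ultimately show "sum_power V ?A r + sum_power V ?B s \<subseteq>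
        sum_power V ?A (r + s) \<inter> sum_power V ?B s"
      by (simp add: sum_power_add[OF A])
  next
    show "sum_power V ?A (r + s) \<inter> sum_power V ?B s \<subseteq> sum_power V ?A r + sum_power V ?B s"
    proof
      fix t assume t: "t \<in> sum_power V ?A (r + s) \<inter> sum_power V ?B s"
      obtain i j where ij: "i + j = r + s" "t \<in> sum_power V A1 i" "t \<in> sum_power V A2 j"
        using t sum_power_UnE[OF ideals(1,3)] by blast
      obtain a b where ab: "a + b = s" "t \<in> sum_power V B1 a" "t \<in> sum_power V B2 b"
        using t sum_power_UnE[OF ideals(2,4)] by blast
      let ?P = "sum_power V A1 (i - a) + sum_power V B1 a"
      let ?Q = "sum_power V A2 (j - b) + sum_power V B2 b"
      have "t \<in> ?P \<inter> ?Q"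
        using exponent_demotion_truncated[OF dem(1) ij(2) ab(2)]
          exponent_demotion_truncated[OF dem(2) ij(3) ab(3)] by blast
      also have "?P \<inter> ?Q = ?P + ?Q"
        by (rule cylindrical_Int_eq_plus[OF _ _ _ _ W])
          (intro exponent_ideal_plus pow ideals cylindrical_plus cylindrical_sum_power cyl1 cyl2)+
      also have "\<dots> \<subseteq> (sum_power V ?A (i - a) + sum_power V ?B a) +
          (sum_power V ?A (j - b) + sum_power V ?B b)"
        by (intro set_plus_mono2 sum_power_mono) auto
      also have "\<dots> = sum_power V ?A ((i - a) + (j - b)) + sum_power V ?B s"
        by (simp add: sum_power_add[OF A] sum_power_add[OF B] ac_simps flip: ab(1))
      also have "\<dots> \<subseteq> sum_power V ?A r + sum_power V ?B s"
        using ij(1) ab(1) by (intro set_plus_mono2 sum_power_antimono[OF A]) auto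
      finally show "t \<in> sum_power V ?A r + sum_power V ?B s" .
    qed
  qed
qed

section \<open>Monomial ideals and their exponent sets\<close>

text \<open>For a set \<open>A\<close> that is an \<^const>\<open>exponent_ideal\<close> over \<open>V\<close>, this linear span is already the
  ideal of \<open>K[x\<^sub>i | i \<in> V]\<close> generated by the monomials with exponents in \<open>A\<close>. As its definition
  mentions neither \<open>V\<close> nor generators, inclusions and intersections are immediate.\<close>

definition mono_span :: "exponent set \<Rightarrow> 'k::field mpoly set"
  where "mono_span A = {p. Poly_Mapping.keys p \<subseteq> A}"

lemma carrier_poly_ring: "carrier (poly_ring V) = mono_span (exponents V)"
  by (auto simp: poly_ring_def mono_span_def exponents_def)

lemma single_in_mono_span: "t \<in> A \<Longrightarrow> Poly_Mapping.single t c \<in> mono_span A"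
  by (simp add: mono_span_def)

lemma mono_span_Int: "mono_span A \<inter> mono_span B = mono_span (A \<inter> B)"
  by (auto simp: mono_span_def)

lemma mono_span_subset_iff: "(mono_span A :: 'k::field mpoly set) \<subseteq> mono_span B \<longleftrightarrow> A \<subseteq> B"
proof
  assume sub: "(mono_span A :: 'k mpoly set) \<subseteq> mono_span B"
  show "A \<subseteq> B"
  proof
    fix t assume "t \<in> A"
    then have "Poly_Mapping.single t (1::'k) \<in> mono_span B"
      using sub single_in_mono_span by blast
    then show "t \<in> B"
      by (simp add: mono_span_def)
  qed
qed (auto simp: mono_span_def)

lemma mono_span_eq_iff: "(mono_span A :: 'k::field mpoly set) = mono_span B \<longleftrightarrow> A = B"
  using mono_span_subset_iff by (metis order_antisym order_refl)

lemma genideal_single_image: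
  assumes "exponent_ideal V A"
  shows "Idl\<^bsub>poly_ring V\<^esub> ((\<lambda>a. Poly_Mapping.single a (1::'k::field)) ` A) = mono_span A"
proof -
  have sub: "A \<subseteq> exponents V"
    using assms by (simp add: exponent_ideal_def)
  have "t \<in> A" if "t \<in> exponents V" "t = a + w" "a \<in> A" for t a w
    using assms that set_plus_intro[of a A w "exponents V"]
    by (auto simp: exponent_ideal_def add_in_exponents_iff)
  moreover have "\<exists>a \<in> A. \<exists>w. t = a + w" if "t \<in> A" for t
    using that by (metis add.right_neutral)
  moreover have "Idl\<^bsub>poly_ring V\<^esub> ((\<lambda>a. Poly_Mapping.single a (1::'k::field)) ` A) =
      {p \<in> mono_span (exponents V). \<forall>t \<in> Poly_Mapping.keys p. \<exists>a \<in> A. \<exists>w. t = a + w}"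
    using sub by (subst genideal_monomials) (auto simp: exponents_def carrier_poly_ring)
  ultimately show ?thesis
    using sub unfolding mono_span_def by blast
qed

lemma ideal_mono_span:
  assumes "exponent_ideal V A"
  shows "ideal (mono_span A :: 'k::field mpoly set) (poly_ring V)"
proof -
  interpret cring "poly_ring V :: 'k mpoly ring"
    by (rule cring_poly_ring)
  have "(\<lambda>a. Poly_Mapping.single a (1::'k)) ` A \<subseteq> carrier (poly_ring V)"
    using assms by (auto simp: carrier_poly_ring exponent_ideal_def intro!: single_in_mono_span)
  from genideal_ideal[OF this] show ?thesis
    by (simp add: genideal_single_image[OF assms])
qed

lemma mono_span_subset_ideal:
  assumes "exponent_ideal V A" "ideal I (poly_ring V :: 'k::field mpoly ring)"
    and "\<And>t. t \<in> A \<Longrightarrow> Poly_Mapping.single t 1 \<in> I"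
  shows "mono_span A \<subseteq> I"
proof -
  interpret cring "poly_ring V :: 'k mpoly ring"
    by (rule cring_poly_ring)
  show ?thesis
    using genideal_minimal[OF assms(2), of "(\<lambda>a. Poly_Mapping.single a 1) ` A"] assms(3)
    by (auto simp: genideal_single_image[OF assms(1)])
qed

lemma set_add_mono_span:
  assumes "exponent_ideal V A" "exponent_ideal V B"
  shows "mono_span A <+>\<^bsub>poly_ring V :: 'k::field mpoly ring\<^esub> mono_span B = mono_span (A \<union> B)"
proof
  interpret cring "poly_ring V :: 'k mpoly ring"
    by (rule cring_poly_ring)
  show "mono_span A <+>\<^bsub>poly_ring V :: 'k mpoly ring\<^esub> mono_span B \<subseteq> mono_span (A \<union> B)"
  proof
    fix p assume "p \<in> mono_span A <+>\<^bsub>poly_ring V :: 'k mpoly ring\<^esub> mono_span B"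
    then obtain q q' where "p = q + q'" "q \<in> mono_span A" "q' \<in> mono_span B"
      by (auto simp: set_add_def' poly_ring_def)
    then show "p \<in> mono_span (A \<union> B)"
      using keys_add[of q q'] by (auto simp: mono_span_def)
  qed
  show "mono_span (A \<union> B) \<subseteq> mono_span A <+>\<^bsub>poly_ring V :: 'k mpoly ring\<^esub> mono_span B"
  proof (rule mono_span_subset_ideal[OF exponent_ideal_Un[OF assms]
        add_ideals[OF ideal_mono_span[OF assms(1)] ideal_mono_span[OF assms(2)]]])
    fix t assume "t \<in> A \<union> B"
    then have "(Poly_Mapping.single t (1::'k), 0) \<in> mono_span A \<times> mono_span B \<or>
        (0, Poly_Mapping.single t (1::'k)) \<in> mono_span A \<times> mono_span B"
      by (auto simp: mono_span_def)
    then show "Poly_Mapping.single t 1 \<in> mono_span A <+>\<^bsub>poly_ring V :: 'k mpoly ring\<^esub> mono_span B"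
      by (force simp: set_add_def' poly_ring_def)
  qed
qed

lemma ideal_prod_mono_span:
  assumes "exponent_ideal V A" "exponent_ideal V B"
  shows "mono_span A \<cdot>\<^bsub>poly_ring V :: 'k::field mpoly ring\<^esub> mono_span B = mono_span (A + B)"
proof
  interpret cring "poly_ring V :: 'k mpoly ring"
    by (rule cring_poly_ring)
  show "mono_span A \<cdot>\<^bsub>poly_ring V :: 'k mpoly ring\<^esub> mono_span B \<subseteq> mono_span (A + B)"
  proof
    fix p assume "p \<in> mono_span A \<cdot>\<^bsub>poly_ring V :: 'k mpoly ring\<^esub> mono_span B"
    then show "p \<in> mono_span (A + B)"
    proof (induction rule: ideal_prod.induct)
      case (prod q q')
      then show ?case
        using keys_mult[of q q'] by (fastforce simp: mono_span_def poly_ring_def intro: set_plus_intro)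
    next
      case (sum q q')
      then show ?case
        using keys_add[of q q'] by (auto simp: mono_span_def poly_ring_def)
    qed
  qed
  show "mono_span (A + B) \<subseteq> mono_span A \<cdot>\<^bsub>poly_ring V :: 'k mpoly ring\<^esub> mono_span B"
  proof (rule mono_span_subset_ideal[OF exponent_ideal_plus[OF assms]
        ideal_prod_is_ideal[OF ideal_mono_span[OF assms(1)] ideal_mono_span[OF assms(2)]]])
    fix t assume "t \<in> A + B"
    then obtain a b where t: "t = a + b" "a \<in> A" "b \<in> B"
      by (auto elim: set_plus_elim)
    have "Poly_Mapping.single a 1 \<otimes>\<^bsub>poly_ring V :: 'k mpoly ring\<^esub> Poly_Mapping.single b 1
        \<in> mono_span A \<cdot>\<^bsub>poly_ring V :: 'k mpoly ring\<^esub> mono_span B"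
      using t by (intro ideal_prod.prod single_in_mono_span)
    then show "Poly_Mapping.single t 1 \<in> mono_span A \<cdot>\<^bsub>poly_ring V :: 'k mpoly ring\<^esub> mono_span B"
      by (simp add: poly_ring_def mult_single t(1))
  qed
qed

lemma ideal_power_mono_span:
  assumes "exponent_ideal V A"
  shows "mono_span A [^]\<^bsub>ideals_set (poly_ring V :: 'k::field mpoly ring)\<^esub> k =
    mono_span (sum_power V A k)"
proof (induction k)
  case 0
  then show ?case
    by (simp add: nat_pow_def ideals_set_def carrier_poly_ring)
next
  case (Suc k)
  then show ?case
    using ideal_prod_mono_span[OF exponent_ideal_sum_power[OF assms, of k] assms, where 'k = 'k]
    by (simp add: nat_pow_def ideals_set_def)
qed

lemma demotion_mono_span_iff:
  assumes "exponent_ideal V A" "exponent_ideal V B"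
  shows "demotion (poly_ring V :: 'k::field mpoly ring) (mono_span B) (mono_span A) \<longleftrightarrow>
    exponent_demotion V B A"
  using assms
  by (simp add: demotion_def exponent_demotion_def ideal_mono_span mono_span_subset_iff
      ideal_power_mono_span ideal_prod_mono_span exponent_ideal_sum_power mono_span_Int
      mono_span_eq_iff)

text \<open>Every exponent of \<open>I\<close> is \<open>a + w\<close> for the exponent \<open>a\<close> of a minimal generator. Restricting it
  to \<open>W\<close> leaves \<open>a\<close> unchanged and only shrinks \<open>w\<close>, so the result is still an exponent of \<open>I\<close>.\<close>

lemma monomial_ideal_cylindricalE:
  assumes "monomial_ideal V I"
    and gens: "min_monomial_gens V I \<subseteq> carrier (poly_ring W :: 'k::field mpoly ring)"
  obtains A where "exponent_ideal V A" "cylindrical W A" "I = mono_span A"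
proof -
  define G where "G = min_monomial_gens V I"
  have "is_min_monomial_gens V I G"
    unfolding G_def min_monomial_gens_def
    by (rule theI'[OF ex1_min_monomial_gens[OF assms(1)]])
  then have G: "G \<subseteq> monomials V" "Idl\<^bsub>poly_ring V\<^esub> G = I"
    by (auto simp: is_min_monomial_gens_def)
  define S where "S = {t. Poly_Mapping.single t (1::'k) \<in> G}"
  have G_eq: "G = (\<lambda>a. Poly_Mapping.single a 1) ` S"
    using G(1) by (auto simp: S_def monomials_def)
  have SV: "S \<subseteq> exponents V"
  proof
    fix t assume "t \<in> S"
    then obtain t' where "Poly_Mapping.single t (1::'k) = Poly_Mapping.single t' 1"
      and t': "t' \<in> exponents V"
      using G(1) by (auto simp: S_def monomials_def exponents_def)
    then have "Poly_Mapping.keys (Poly_Mapping.single t (1::'k)) =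
        Poly_Mapping.keys (Poly_Mapping.single t' (1::'k))"
      by simp
    with t' show "t \<in> exponents V"
      by simp
  qed
  have SW: "S \<subseteq> exponents W"
    using gens by (auto simp: S_def carrier_poly_ring mono_span_def simp flip: G_def)
  define A where "A = S + exponents V"
  show thesis
  proof
    show A: "exponent_ideal V A"
      unfolding exponent_ideal_def A_def
    proof
      show "S + exponents V \<subseteq> exponents V"
        using SV by (auto simp: add_in_exponents_iff elim!: set_plus_elim)
      show "S + exponents V + exponents V \<subseteq> S + exponents V"
        using exponent_ideal_plus_exponents[OF exponent_ideal_exponents] by (simp add: add.assoc)
    qed
    show "cylindrical W A"
      unfolding cylindrical_def
    proof
      fix t assume "t \<in> A"
      then obtain a w where "t = a + w" "a \<in> S" "w \<in> exponents V"
        by (auto simp: A_def elim: set_plus_elim)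
      then show "restrict_exponent W t \<in> A"
        using SW by (auto simp: A_def restrict_exponent_add restrict_exponent_ident
            restrict_in_exponents intro!: set_plus_intro)
    qed
    have "I = {p \<in> mono_span (exponents V).
        \<forall>t \<in> Poly_Mapping.keys p. \<exists>a \<in> S. \<exists>w. t = a + w}"
      using G(2) SV unfolding G_eq
      by (subst (asm) genideal_monomials) (auto simp: exponents_def carrier_poly_ring)
    also have "\<dots> = mono_span A"
    proof -
      have "t \<in> A \<longleftrightarrow> t \<in> exponents V \<and> (\<exists>a \<in> S. \<exists>w. t = a + w)" for t
        using SV by (auto simp: A_def add_in_exponents_iff elim!: set_plus_elim intro: set_plus_intro)
      then show ?thesis
        unfolding mono_span_def by blast
    qed
    finally show "I = mono_span A" .
  qed
qed

theorem proposition5p2: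
  fixes n m :: nat and I1 J1 I2 J2 :: "'k::field mpoly set"
  assumes "1 \<le> m" and "m \<le> n"
    and "monomial_ideal {1..n} I1" and "monomial_ideal {1..n} J1"
    and "monomial_ideal {1..n} I2" and "monomial_ideal {1..n} J2"
    and "J1 \<subseteq> I1" and "J2 \<subseteq> I2"
    and "min_monomial_gens {1..n} I1 \<subseteq> carrier (poly_ring {1..m})"
    and "min_monomial_gens {1..n} J1 \<subseteq> carrier (poly_ring {1..m})"
    and "min_monomial_gens {1..n} I2 \<subseteq> carrier (poly_ring {m+1..n})"
    and "min_monomial_gens {1..n} J2 \<subseteq> carrier (poly_ring {m+1..n})"
    and "demotion (poly_ring {1..n}) J1 I1"
    and "demotion (poly_ring {1..n}) J2 I2"
  shows "demotion (poly_ring {1..n}) (J1 <+>\<^bsub>poly_ring {1..n}\<^esub> J2) (I1 <+>\<^bsub>poly_ring {1..n}\<^esub> I2)"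
proof -
  obtain A1 where A1: "exponent_ideal {1..n} A1" "cylindrical {1..m} A1" "I1 = mono_span A1"
    using monomial_ideal_cylindricalE[OF assms(3,9)] .
  obtain B1 where B1: "exponent_ideal {1..n} B1" "cylindrical {1..m} B1" "J1 = mono_span B1"
    using monomial_ideal_cylindricalE[OF assms(4,10)] .
  obtain A2 where A2: "exponent_ideal {1..n} A2" "cylindrical {m+1..n} A2" "I2 = mono_span A2"
    using monomial_ideal_cylindricalE[OF assms(5,11)] .
  obtain B2 where B2: "exponent_ideal {1..n} B2" "cylindrical {m+1..n} B2" "J2 = mono_span B2"
    using monomial_ideal_cylindricalE[OF assms(6,12)] .
  have "exponent_demotion {1..n} B1 A1"
    using assms(13) demotion_mono_span_iff[OF A1(1) B1(1), where 'k = 'k] by (simp add: A1(3) B1(3))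
  moreover have "exponent_demotion {1..n} B2 A2"
    using assms(14) demotion_mono_span_iff[OF A2(1) B2(1), where 'k = 'k] by (simp add: A2(3) B2(3))
  moreover have "{1..n} = {1..m} \<union> {m+1..n}" "{1..m} \<inter> {m+1..n} = {}"
    using assms(2) by auto
  ultimately have "exponent_demotion {1..n} (B1 \<union> B2) (A1 \<union> A2)"
    using A1(1,2) B1(1,2) A2(1,2) B2(1,2) by (intro exponent_demotion_Un)
  then have "demotion (poly_ring {1..n} :: 'k mpoly ring) (mono_span (B1 \<union> B2)) (mono_span (A1 \<union> A2))"
    using demotion_mono_span_iff[OF exponent_ideal_Un[OF A1(1) A2(1)]
        exponent_ideal_Un[OF B1(1) B2(1)]] by blast
  then show ?thesis
    unfolding A1(3) A2(3) B1(3) B2(3) set_add_mono_span[OF A1(1) A2(1)]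
      set_add_mono_span[OF B1(1) B2(1)] .
qed

end
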